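(* Let $(X,\operatorname{dist})$ be a compact metric space and let $f\colon X\to X$ be a homeomorphism that is minimal and separating. Then $f$ is expansive.
   Context: Let $f\colon X\to X$ be a homeomorphism of a compact metric space $(X,\operatorname{dist})$. The orbit of $x\in X$ is $O(x)=\{f^n(x):n\in\mathbb Z\}$. The homeomorphism $f$ is minimal if every orbit is dense in $X$ (equivalently, $X$ has no proper nonempty closed $f$-invariant subset). It is separating if there is $\eta>0$ such that whenever $x,y\in X$ and $y\notin O(x)$, one has $\operatorname{dist}(f^n(x),f^n(y))>\eta$ for some $n\in\mathbb Z$. It is expansive if there is $\eta>0$ such that whenever $x,y\in X$ and $x\neq y$, one has $\operatorname{dist}(f^n(x),f^n(y))>\eta$ for some $n\in\mathbb Z$. *)

theory Defs
  imports "HOL-Analysis.Analysis"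
begin

text \<open>
  The space is a subset \<open>X\<close> of a metric-space type, with the induced metric, and \<open>f\<close> is a
  function that is meaningful on \<open>X\<close> only. The inverse is therefore taken relative to \<open>X\<close>;
  \<open>int_iter X f n\<close> is the integer iterate of \<open>f\<close> on points of \<open>X\<close> whenever \<open>f\<close> is a
  bijection of \<open>X\<close> onto itself.
\<close>

definition int_iter :: "'a set \<Rightarrow> ('a \<Rightarrow> 'a) \<Rightarrow> int \<Rightarrow> 'a \<Rightarrow> 'a" where
  "int_iter X f n = (if 0 \<le> n then f ^^ nat n else inv_into X f ^^ nat (- n))"

definition full_orbit :: "'a set \<Rightarrow> ('a \<Rightarrow> 'a) \<Rightarrow> 'a \<Rightarrow> 'a set" where
  "full_orbit X f x = range (\<lambda>n. int_iter X f n x)"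

definition minimal_on :: "'a::metric_space set \<Rightarrow> ('a \<Rightarrow> 'a) \<Rightarrow> bool" where
  "minimal_on X f \<longleftrightarrow> (\<forall>x\<in>X. X \<subseteq> closure (full_orbit X f x))"

definition separating_on :: "'a::metric_space set \<Rightarrow> ('a \<Rightarrow> 'a) \<Rightarrow> bool" where
  "separating_on X f \<longleftrightarrow>
    (\<exists>\<eta>>0. \<forall>x\<in>X. \<forall>y\<in>X. y \<notin> full_orbit X f x \<longrightarrow>
      (\<exists>n. dist (int_iter X f n x) (int_iter X f n y) > \<eta>))"

definition expansive_on :: "'a::metric_space set \<Rightarrow> ('a \<Rightarrow> 'a) \<Rightarrow> bool" where
  "expansive_on X f \<longleftrightarrow>
    (\<exists>\<eta>>0. \<forall>x\<in>X. \<forall>y\<in>X. x \<noteq> y \<longrightarrow>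
      (\<exists>n. dist (int_iter X f n x) (int_iter X f n y) > \<eta>))"

end

theory Submission
  imports Defs
begin

text \<open>
  Let \<open>\<eta>\<close> be a separation constant and suppose that \<open>f\<close> is not expansive. Then for every
  \<open>\<epsilon> \<le> \<eta>\<close> there are two distinct points whose full orbits stay \<open>\<epsilon>\<close>-close. By separation they
  lie on one orbit, say they are \<open>a\<close> and \<open>f\<^sup>k a\<close>, so \<open>f\<^sup>k\<close> moves every point of the orbit of
  \<open>a\<close> by at most \<open>\<epsilon>\<close>. The orbit is dense, so \<open>f\<^sup>k\<close> moves every point of \<open>X\<close> by at most \<open>\<epsilon>\<close>
  (\<open>displacement_bound_from_orbit\<close>). The same density argument with bound \<open>0\<close> shows that \<open>f\<^sup>k\<close>
  has no fixed point, because a fixed point would force \<open>f\<^sup>k a = a\<close>.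

  Fix \<open>x \<in> X\<close> and let \<open>\<Gamma>\<close> be the set of points whose orbits stay \<open>r\<close>-close to that of \<open>x\<close> for
  some \<open>r < \<eta>\<close>. If \<open>y \<in> \<Gamma>\<close> then \<open>f\<^sup>k y\<close> is different from \<open>y\<close>, within \<open>\<epsilon>\<close> of \<open>y\<close>, and
  again in \<open>\<Gamma>\<close> when \<open>\<epsilon>\<close> is small; so \<open>\<Gamma>\<close> has no isolated points and its closure is a
  nonempty perfect compact set. By the Baire category theorem this closure is uncountable
  (\<open>uncountable_perfect_compact\<close>). But the points of the closure stay \<open>\<eta>\<close>-close to \<open>x\<close> along
  the orbit, so by separation they all lie in the countable orbit of \<open>x\<close>: a contradiction.
\<close>

section \<open>Perfect compact sets\<close>

text \<open>
  A countable compact set would be a countable union of singletons, which have empty relative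
  interior when no point is isolated; this is what the Baire category theorem forbids.
\<close>

lemma uncountable_perfect_compact:
  fixes K :: "'a::metric_space set"
  assumes "compact K" "K \<noteq> {}" and perfect: "\<And>x. x \<in> K \<Longrightarrow> x islimpt K"
  shows "uncountable K"
proof
  assume "countable K"
  have "top_of_set K interior_of \<Union>((\<lambda>x. {x}) ` K) = {}"
  proof (rule Baire_category_alt)
    have "compact_space (top_of_set K)"
      using \<open>compact K\<close> by (simp add: compact_space_subtopology)
    moreover have "Hausdorff_space (top_of_set K)"
      by (simp add: Hausdorff_space_subtopology)
    ultimately show "completely_metrizable_space (top_of_set K) \<or>
        locally_compact_space (top_of_set K) \<and> regular_space (top_of_set K)"
      by (simp add: compact_imp_locally_compact_space compact_Hausdorff_imp_regular_space)
    show "countable ((\<lambda>x. {x}) ` K)"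
      using \<open>countable K\<close> by simp
    fix T assume "T \<in> (\<lambda>x. {x}) ` K"
    then obtain x where x: "x \<in> K" "T = {x}"
      by auto
    have "\<not> openin (top_of_set K) {x}"
    proof
      assume "openin (top_of_set K) {x}"
      then obtain U where "open U" "{x} = K \<inter> U"
        by (auto simp: openin_open)
      then show False
        using perfect[OF x(1)] unfolding islimpt_def by blast
    qed
    then have "top_of_set K interior_of T = {}"
      using x interior_of_subset[of "top_of_set K" T] openin_interior_of[of "top_of_set K" T]
      by (metis subset_singletonD)
    then show "closedin (top_of_set K) T \<and> top_of_set K interior_of T = {}"
      using x by (simp add: closed_subset)
  qed
  then show False
    using \<open>K \<noteq> {}\<close> interior_of_topspace[of "top_of_set K"] by simp
qed

section \<open>Integer iterates of a homeomorphism\<close>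

lemma homeomorphism_inv_into:
  assumes "homeomorphism X X f g"
  shows "homeomorphism X X f (inv_into X f)"
proof -
  have "inj_on f X"
    using assms by (metis homeomorphism_apply1 inj_onI)
  then have "inv_into X f y = g y" if "y \<in> X" for y
    using assms that
    by (metis homeomorphism_apply2 homeomorphism_image2 imageI inv_into_f_f)
  then show ?thesis
    by (intro homeomorphism_cong[OF assms]) auto
qed

lemma funpow_invariant:
  assumes "p ` X \<subseteq> X" "x \<in> X"
  shows "(p ^^ n) x \<in> X"
  using assms by (induction n) auto

lemma continuous_on_funpow:
  assumes "continuous_on X p" "p ` X \<subseteq> X"
  shows "continuous_on X (p ^^ n)"
proof (induction n)
  case (Suc n)
  have "(p ^^ n) ` X \<subseteq> X"
    by (auto intro: funpow_invariant[OF assms(2)])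
  then have "continuous_on X (p \<circ> (p ^^ n))"
    by (intro continuous_on_compose Suc continuous_on_subset[OF assms(1)])
  then show ?case
    by simp
qed (simp add: id_def continuous_on_id)

lemma funpow_commute_on:
  assumes p: "p ` X \<subseteq> X" and q: "q ` X \<subseteq> X"
    and comm: "\<And>x. x \<in> X \<Longrightarrow> p (q x) = q (p x)" and x: "x \<in> X"
  shows "(p ^^ m) ((q ^^ n) x) = (q ^^ n) ((p ^^ m) x)"
proof -
  have one: "p ((q ^^ n) x) = (q ^^ n) (p x)" if "x \<in> X" for x
    using that by (induction n) (simp_all add: comm funpow_invariant[OF q])
  show ?thesis
    using x by (induction m) (simp_all add: one funpow_invariant[OF p])
qed

context
  fixes X :: "'a::metric_space set" and f g
  assumes hom: "homeomorphism X X f g"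
begin

lemma int_iter_in: "x \<in> X \<Longrightarrow> int_iter X f n x \<in> X"
  using homeomorphism_inv_into[OF hom]
  by (simp add: int_iter_def homeomorphism_def funpow_invariant)

lemma continuous_on_int_iter: "continuous_on X (int_iter X f n)"
  using homeomorphism_inv_into[OF hom]
  by (simp add: int_iter_def homeomorphism_def continuous_on_funpow)

lemma int_iter_commute:
  assumes "x \<in> X"
  shows "int_iter X f m (int_iter X f n x) = int_iter X f n (int_iter X f m x)"
proof -
  let ?h = "inv_into X f"
  have inv: "f ` X \<subseteq> X" "?h ` X \<subseteq> X" "\<And>x. x \<in> X \<Longrightarrow> f (?h x) = ?h (f x)"
    using homeomorphism_inv_into[OF hom] by (auto simp: homeomorphism_def)
  have "p \<in> {f, ?h} \<Longrightarrow> q \<in> {f, ?h} \<Longrightarrow> (p ^^ i) ((q ^^ j) x) = (q ^^ j) ((p ^^ i) x)" for p q i j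
    using inv assms by (intro funpow_commute_on) auto
  then show ?thesis
    by (simp add: int_iter_def)
qed

text \<open>
  Since \<open>f\<^sup>n (f\<^sup>k a) = f\<^sup>k (f\<^sup>n a)\<close>, closeness of the orbits of \<open>a\<close> and \<open>f\<^sup>k a\<close> bounds the
  displacement of \<open>f\<^sup>k\<close> on the orbit of \<open>a\<close>, and by density and continuity everywhere.
\<close>

lemma displacement_bound_from_orbit:
  assumes min: "minimal_on X f" and "a \<in> X" "z \<in> X"
    and close: "\<And>n. dist (int_iter X f n a) (int_iter X f n (int_iter X f k a)) \<le> \<epsilon>"
  shows "dist z (int_iter X f k z) \<le> \<epsilon>"
proof -
  let ?O = "full_orbit X f a"
  have sub: "?O \<subseteq> X"
    using \<open>a \<in> X\<close> int_iter_in by (auto simp: full_orbit_def)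
  have "z \<in> closure ?O"
    using min \<open>a \<in> X\<close> \<open>z \<in> X\<close> by (auto simp: minimal_on_def)
  then obtain s where s: "\<And>i. s i \<in> ?O" "s \<longlonglongrightarrow> z"
    by (auto simp: closure_sequential)
  have "(\<lambda>i. int_iter X f k (s i)) \<longlonglongrightarrow> int_iter X f k z"
  proof (rule continuous_on_tendsto_compose[OF continuous_on_int_iter s(2) \<open>z \<in> X\<close>])
    show "\<forall>\<^sub>F i in sequentially. s i \<in> X"
      using s(1) sub by (simp add: subset_iff)
  qed
  then have "(\<lambda>i. dist (s i) (int_iter X f k (s i))) \<longlonglongrightarrow> dist z (int_iter X f k z)"
    using s(2) by (rule tendsto_dist[rotated])
  moreover have "dist (s i) (int_iter X f k (s i)) \<le> \<epsilon>" for i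
    using s(1)[of i] close int_iter_commute[OF \<open>a \<in> X\<close>] by (auto simp: full_orbit_def)
  ultimately show ?thesis
    by (meson LIMSEQ_le_const2)
qed

section \<open>Small displacements of a non-expansive minimal separating homeomorphism\<close>

text \<open>
  Two distinct points with close orbits lie on one orbit by separation, which gives \<open>k\<close>. The
  displacement bound at \<open>f\<^sup>n y\<close> yields the bound along the whole orbit of \<open>y\<close>, and the case
  \<open>\<epsilon> = 0\<close> of the same bound, started from a fixed point, would make \<open>f\<^sup>k\<close> the identity.
\<close>

lemma small_fixed_point_free_iterate:
  assumes min: "minimal_on X f" and sep: "separating_on X f"
    and nonexp: "\<not> expansive_on X f" and "\<epsilon> > 0"
  obtains k where "\<And>y. y \<in> X \<Longrightarrow> int_iter X f k y \<noteq> y"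
    and "\<And>y n. y \<in> X \<Longrightarrow> dist (int_iter X f n y) (int_iter X f n (int_iter X f k y)) \<le> \<epsilon>"
proof -
  obtain \<eta> where "\<eta> > 0"
    and \<eta>: "\<And>x y. \<lbrakk>x \<in> X; y \<in> X; \<And>n. dist (int_iter X f n x) (int_iter X f n y) \<le> \<eta>\<rbrakk>
                 \<Longrightarrow> y \<in> full_orbit X f x"
    using sep unfolding separating_on_def by (metis not_less)
  \<comment> \<open>closeness within \<open>\<eta>\<close> is what puts the pair on one orbit\<close>
  have "min \<epsilon> \<eta> > 0"
    using \<open>\<epsilon> > 0\<close> \<open>\<eta> > 0\<close> by simp
  then obtain a b where ab: "a \<in> X" "b \<in> X" "a \<noteq> b"
    and close: "\<And>n. dist (int_iter X f n a) (int_iter X f n b) \<le> min \<epsilon> \<eta>"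
    using nonexp unfolding expansive_on_def by (metis not_less)
  have "b \<in> full_orbit X f a"
    using \<eta>[OF ab(1,2)] close by auto
  then obtain k where k: "b = int_iter X f k a"
    by (auto simp: full_orbit_def)
  show thesis
  proof
    fix y assume "y \<in> X"
    show "int_iter X f k y \<noteq> y"
    proof
      assume "int_iter X f k y = y"
      then have "dist a (int_iter X f k a) \<le> 0"
        using displacement_bound_from_orbit[OF min \<open>y \<in> X\<close> \<open>a \<in> X\<close>, of k 0] by simp
      then show False
        using ab k by simp
    qed
    fix n
    have "dist (int_iter X f n y) (int_iter X f k (int_iter X f n y)) \<le> \<epsilon>"
      using displacement_bound_from_orbit[OF min \<open>a \<in> X\<close> int_iter_in[OF \<open>y \<in> X\<close>]] close k
      by simp
    then show "dist (int_iter X f n y) (int_iter X f n (int_iter X f k y)) \<le> \<epsilon>"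
      by (simp add: int_iter_commute[OF \<open>y \<in> X\<close>])
  qed
qed

text \<open>
  The strict inequality \<open>r < \<eta>\<close> leaves room for a further small displacement; the points whose
  orbits are merely \<open>\<eta>\<close>-close to that of \<open>x\<close> need not be stable under it.
\<close>

lemma islimpt_orbit_shadowing_set:
  fixes x \<eta>
  defines "\<Gamma> \<equiv> {y \<in> X. \<exists>r<\<eta>. \<forall>n. dist (int_iter X f n x) (int_iter X f n y) \<le> r}"
  assumes min: "minimal_on X f" and sep: "separating_on X f"
    and nonexp: "\<not> expansive_on X f" and "y \<in> \<Gamma>"
  shows "y islimpt \<Gamma>"
  unfolding islimpt_approachable
proof (intro allI impI)
  fix e :: real assume "e > 0"
  obtain r where r: "r < \<eta>" "\<And>n. dist (int_iter X f n x) (int_iter X f n y) \<le> r" and "y \<in> X"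
    using \<open>y \<in> \<Gamma>\<close> by (auto simp: \<Gamma>_def)
  define \<epsilon> where "\<epsilon> = min e (\<eta> - r) / 2"
  have \<epsilon>: "\<epsilon> > 0" "\<epsilon> < e" "r + \<epsilon> < \<eta>"
    using \<open>e > 0\<close> \<open>r < \<eta>\<close> by (auto simp: \<epsilon>_def min_def field_simps)
  obtain k where k: "int_iter X f k y \<noteq> y"
    "\<And>n. dist (int_iter X f n y) (int_iter X f n (int_iter X f k y)) \<le> \<epsilon>"
    using small_fixed_point_free_iterate[OF min sep nonexp \<open>\<epsilon> > 0\<close>] \<open>y \<in> X\<close> by metis
  have "dist (int_iter X f n x) (int_iter X f n (int_iter X f k y)) \<le> r + \<epsilon>" for n
    using r(2)[of n] k(2)[of n]
      dist_triangle[of "int_iter X f n x" "int_iter X f n (int_iter X f k y)" "int_iter X f n y"]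
    by linarith
  then have "int_iter X f k y \<in> \<Gamma>"
    using \<epsilon>(3) int_iter_in[OF \<open>y \<in> X\<close>] by (auto simp: \<Gamma>_def)
  moreover have "dist (int_iter X f k y) y < e"
    using k(2)[of 0] \<epsilon>(2) by (simp add: int_iter_def dist_commute)
  ultimately show "\<exists>y'\<in>\<Gamma>. y' \<noteq> y \<and> dist y' y < e"
    using k(1) by blast
qed

end

section \<open>Expansiveness\<close>

theorem corollary2p7:
  fixes X :: "'a::metric_space set" and f g :: "'a \<Rightarrow> 'a"
  assumes "compact X"
    and "homeomorphism X X f g"
    and "minimal_on X f"
    and "separating_on X f"
  shows "expansive_on X f"
proof (rule ccontr)
  assume nonexp: "\<not> expansive_on X f"
  obtain x where "x \<in> X"
    using nonexp by (auto simp: expansive_on_def intro: zero_less_one)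
  obtain \<eta> where "\<eta> > 0"
    and \<eta>: "\<And>y. \<lbrakk>y \<in> X; \<And>n. dist (int_iter X f n x) (int_iter X f n y) \<le> \<eta>\<rbrakk>
               \<Longrightarrow> y \<in> full_orbit X f x"
    using \<open>separating_on X f\<close> \<open>x \<in> X\<close> unfolding separating_on_def by (metis not_less)
  define \<Gamma> where
    "\<Gamma> = {y \<in> X. \<exists>r<\<eta>. \<forall>n. dist (int_iter X f n x) (int_iter X f n y) \<le> r}"
  have limpt: "y islimpt \<Gamma>" if "y \<in> \<Gamma>" for y
    using islimpt_orbit_shadowing_set[OF assms(2-4) nonexp] that unfolding \<Gamma>_def by blast
  have "closure \<Gamma> \<subseteq> X"
    using compact_imp_closed[OF \<open>compact X\<close>] by (intro closure_minimal) (auto simp: \<Gamma>_def)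
  have "compact (closure \<Gamma>)"
    using compact_Int_closed[OF \<open>compact X\<close> closed_closure, of \<Gamma>] \<open>closure \<Gamma> \<subseteq> X\<close>
    by (simp add: inf.absorb2)
  moreover have "x \<in> \<Gamma>"
    using \<open>x \<in> X\<close> \<open>\<eta> > 0\<close> by (auto simp: \<Gamma>_def)
  then have "closure \<Gamma> \<noteq> {}"
    using closure_subset by blast
  moreover have "y islimpt closure \<Gamma>" if "y \<in> closure \<Gamma>" for y
    using that limpt unfolding limpt_of_closure by (auto simp: closure_def)
  ultimately have "uncountable (closure \<Gamma>)"
    by (rule uncountable_perfect_compact)
  moreover have "closure \<Gamma> \<subseteq> full_orbit X f x"
  proof
    fix y assume "y \<in> closure \<Gamma>"
    then have "y \<in> X"
      using \<open>closure \<Gamma> \<subseteq> X\<close> by blast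
    obtain s where s: "\<And>i. s i \<in> \<Gamma>" "s \<longlonglongrightarrow> y"
      using \<open>y \<in> closure \<Gamma>\<close> by (auto simp: closure_sequential)
    have "dist (int_iter X f n x) (int_iter X f n y) \<le> \<eta>" for n
    proof -
      have "(\<lambda>i. int_iter X f n (s i)) \<longlonglongrightarrow> int_iter X f n y"
      proof (rule continuous_on_tendsto_compose[OF _ s(2) \<open>y \<in> X\<close>])
        show "continuous_on X (int_iter X f n)"
          using assms(2) by (rule continuous_on_int_iter)
        show "\<forall>\<^sub>F i in sequentially. s i \<in> X"
          using s(1) by (simp add: \<Gamma>_def)
      qed
      then have "(\<lambda>i. dist (int_iter X f n x) (int_iter X f n (s i)))
          \<longlonglongrightarrow> dist (int_iter X f n x) (int_iter X f n y)"
        by (rule tendsto_dist[OF tendsto_const])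
      moreover have "dist (int_iter X f n x) (int_iter X f n (s i)) \<le> \<eta>" for i
      proof -
        obtain r where "r < \<eta>" "dist (int_iter X f n x) (int_iter X f n (s i)) \<le> r"
          using s(1)[of i] by (auto simp: \<Gamma>_def)
        then show ?thesis
          by linarith
      qed
      ultimately show ?thesis
        by (meson LIMSEQ_le_const2)
    qed
    then show "y \<in> full_orbit X f x"
      using \<eta> \<open>y \<in> X\<close> by blast
  qed
  moreover have "countable (full_orbit X f x)"
    by (simp add: full_orbit_def)
  ultimately show False
    using countable_subset by blast
qed

end
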